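(* For $\rho>0$ and $\delta\ge0$ let $S_{\rho,\delta}^{(3,1)}(t)=K_{-1}+K_0t+K_1t^2+K_2t^3$, where $K_j=K_j(\rho,\delta)=-B_j+\rho(M_j-\delta D_j)\in\mathbb{R}^{2\times2}$ with $$M_{-1}=\tfrac1{560}\begin{pmatrix}1&0\\9&0\end{pmatrix},\ M_0=\tfrac1{560}\begin{pmatrix}80&9\\128&53\end{pmatrix},\ M_1=\tfrac1{560}\begin{pmatrix}53&128\\9&80\end{pmatrix},\ M_2=\tfrac1{560}\begin{pmatrix}0&9\\0&1\end{pmatrix},$$ $$B_{-1}=\tfrac3{40}\begin{pmatrix}-1&0\\-5&0\end{pmatrix},\ B_0=\tfrac3{40}\begin{pmatrix}0&-5\\16&-5\end{pmatrix},\ B_1=\tfrac3{40}\begin{pmatrix}-5&16\\-5&0\end{pmatrix},\ B_2=\tfrac3{40}\begin{pmatrix}0&-5\\0&-1\end{pmatrix},$$ $$D_{-1}=\tfrac32\begin{pmatrix}1&0\\1&0\end{pmatrix},\ D_0=\tfrac32\begin{pmatrix}-8&1\\16&-11\end{pmatrix},\ D_1=\tfrac32\begin{pmatrix}-11&16\\1&-8\end{pmatrix},\ D_2=\tfrac32\begin{pmatrix}0&1\\0&1\end{pmatrix}.$$ Let $\delta\ge17/1680$. Then, for all $\rho>0$, the polynomial $S_{\rho,\delta}^{(3,1)}$ is of type $(2,2,1)$.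
   Context: A matrix polynomial $S$ is of type $(s,u,\ell)$ if $\det S$ has $s$ zeros of modulus smaller than $1$, $u$ zeros of modulus $1$, and $\ell$ zeros of modulus larger than $1$, counted with multiplicity. ($S_{\rho,\delta}^{(3,1)}$ is the matrix polynomial associated with the block Toeplitz matrices $\widetilde{\mathbf{K}}_n^{(3,1)}(\rho,\delta)$ having block $K_j$ on the $j$th block diagonal, $j>0$ being subdiagonals.) *)

theory Defs
  imports "HOL-Analysis.Analysis" "HOL-Computational_Algebra.Polynomial"
begin

(* A matrix polynomial is a square matrix whose entries are complex polynomials;
   its determinant is a complex polynomial. *)
type_synonym 'n matpoly = "complex poly ^ 'n ^ 'n"

definition zeros_in :: "complex set \<Rightarrow> complex poly \<Rightarrow> nat" where
  "zeros_in A p = (\<Sum>z \<in> {z \<in> A. poly p z = 0}. order z p)"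

(* A nonzero determinant is required: for the zero polynomial the sums above range
   over infinite sets and would take the value 0. *)
definition of_type :: "'n::finite matpoly \<Rightarrow> nat \<Rightarrow> nat \<Rightarrow> nat \<Rightarrow> bool" where
  "of_type S s u l \<longleftrightarrow>
     det S \<noteq> 0 \<and>
     zeros_in {z. norm z < 1} (det S) = s \<and>
     zeros_in {z. norm z = 1} (det S) = u \<and>
     zeros_in {z. norm z > 1} (det S) = l"

(* The index is the number of the block diagonal; all diagonals other than
   -1, 0, 1, 2 vanish.  The matrices are listed by rows. *)
definition M31 :: "int \<Rightarrow> real ^ 2 ^ 2" where
  "M31 j = (1 / 560) *\<^sub>R
    (if j = -1 then vector [vector [1, 0], vector [9, 0]]
     else if j = 0 then vector [vector [80, 9], vector [128, 53]]
     else if j = 1 then vector [vector [53, 128], vector [9, 80]]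
     else if j = 2 then vector [vector [0, 9], vector [0, 1]]
     else 0)"

definition B31 :: "int \<Rightarrow> real ^ 2 ^ 2" where
  "B31 j = (3 / 40) *\<^sub>R
    (if j = -1 then vector [vector [-1, 0], vector [-5, 0]]
     else if j = 0 then vector [vector [0, -5], vector [16, -5]]
     else if j = 1 then vector [vector [-5, 16], vector [-5, 0]]
     else if j = 2 then vector [vector [0, -5], vector [0, -1]]
     else 0)"

definition D31 :: "int \<Rightarrow> real ^ 2 ^ 2" where
  "D31 j = (3 / 2) *\<^sub>R
    (if j = -1 then vector [vector [1, 0], vector [1, 0]]
     else if j = 0 then vector [vector [-8, 1], vector [16, -11]]
     else if j = 1 then vector [vector [-11, 16], vector [1, -8]]
     else if j = 2 then vector [vector [0, 1], vector [0, 1]]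
     else 0)"

definition K31 :: "real \<Rightarrow> real \<Rightarrow> int \<Rightarrow> real ^ 2 ^ 2" where
  "K31 \<rho> \<delta> j = - B31 j + \<rho> *\<^sub>R (M31 j - \<delta> *\<^sub>R D31 j)"

(* S(t) = K_{-1} + K_0 t + K_1 t^2 + K_2 t^3, entrywise. *)
definition S31 :: "real \<Rightarrow> real \<Rightarrow> 2 matpoly" where
  "S31 \<rho> \<delta> = (\<chi> a b.
     [: of_real (K31 \<rho> \<delta> (-1) $ a $ b), of_real (K31 \<rho> \<delta> 0 $ a $ b),
        of_real (K31 \<rho> \<delta> 1 $ a $ b), of_real (K31 \<rho> \<delta> 2 $ a $ b) :])"

end

theory Submission
  imports Defs
begin

text \<open>
  Reversing the rows and the columns of the \<open>2 \<times> 2\<close> matrix \<open>K\<^sub>j\<close> gives \<open>K\<close> at the index \<open>1 - j\<close>, so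
  the determinant is invariant under \<open>p t \<mapsto> t ^ 6 * p (1 / t)\<close>. The matrix at the index \<open>-1\<close> has a
  zero column, so the constant coefficient vanishes, and by symmetry so does the one of \<open>t ^ 6\<close>: the
  determinant is \<open>t\<close> times a palindromic quartic. Hence it equals \<open>t ^ 3 * Q (t + 1 / t)\<close> for a real
  quadratic \<open>Q w = a * w\<^sup>2 + b * w + c\<close>, and its nonzero roots are found by solving \<open>t + 1 / t = w\<close> for the two roots \<open>w\<close> of \<open>Q\<close>. A real \<open>w\<close>
  with \<open>\<bar>w\<bar> < 2\<close> yields a conjugate pair on the unit circle (\<open>w = 2 * cos \<theta>\<close>), while \<open>w > 2\<close>
  yields a reciprocal pair of positive numbers, one on each side of the circle (\<open>w = 2 * cosh x\<close>).

  It therefore suffices that \<open>Q\<close> has one root in \<open>(-2, 2)\<close> and the other beyond \<open>2\<close>, which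
  follows from the signs \<open>Q (-2) < 0\<close>, \<open>Q 2 > 0\<close> and \<open>a < 0\<close>. Together with the root \<open>0\<close>
  this gives the type \<open>(2, 2, 1)\<close>. The bound on \<open>\<delta>\<close> is governed by \<open>Q (-2)\<close>: its coefficient of
  \<open>\<rho>\<^sup>2\<close> is \<open>- 432 * (\<delta> - 17 / 1680) * (\<delta> - 1 / 120)\<close>, so for \<open>\<delta>\<close> slightly below \<open>17 / 1680\<close>
  the sign at \<open>-2\<close> is lost when \<open>\<rho>\<close> is large.

  The lemma \<open>of_type_quintic\<close> carries out the root count from the three signs,
  \<open>det_S31\<close> computes \<open>Q\<close>, and the three sign lemmas establish the hypotheses.
\<close>

section \<open>Counting zeros of products\<close>

lemma zeros_in_superset:
  assumes "p \<noteq> 0" "finite B" "{z \<in> A. poly p z = 0} \<subseteq> B" "B \<subseteq> A"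
  shows "zeros_in A p = (\<Sum>z\<in>B. order z p)"
  unfolding zeros_in_def
  by (rule sum.mono_neutral_left) (use assms in \<open>auto simp: order_eq_0_iff\<close>)

lemma zeros_in_mult:
  assumes "p \<noteq> 0" "q \<noteq> 0"
  shows "zeros_in A (p * q) = zeros_in A p + zeros_in A q"
proof -
  define B where "B = {z \<in> A. poly (p * q) z = 0}"
  have "finite {z. poly (p * q) z = 0}"
    using assms by (intro poly_roots_finite) simp
  then have fin: "finite B"
    unfolding B_def by (rule rev_finite_subset) auto
  have "zeros_in A (p * q) = (\<Sum>z\<in>B. order z p + order z q)"
    using assms by (simp add: zeros_in_def B_def order_mult)
  also have "\<dots> = zeros_in A p + zeros_in A q"
    using zeros_in_superset[OF assms(1) fin, of A] zeros_in_superset[OF assms(2) fin, of A]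
    by (simp add: sum.distrib B_def subset_iff)
  finally show ?thesis .
qed

lemma zeros_in_linear: "zeros_in A [:- x, 1:] = (if x \<in> A then 1 else 0)"
proof -
  have "{z \<in> A. poly [:- x, 1:] z = 0} = (if x \<in> A then {x} else {})"
    by auto
  moreover have "order x [:- x, 1:] = 1"
    using order_power_n_n[of x 1] by simp
  ultimately show ?thesis
    by (simp add: zeros_in_def)
qed

lemma zeros_in_smult:
  assumes "c \<noteq> 0"
  shows "zeros_in A (smult c p) = zeros_in A p"
  using assms by (simp add: zeros_in_def order_smult)

section \<open>Palindromic quartics\<close>

lemma reciprocal_quadratic_factors:
  fixes z z' w :: "'a::comm_ring_1"
  assumes "z * z' = 1" "z + z' = w"
  shows "[:1, - w, 1:] = [:- z, 1:] * [:- z', 1:]"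
  using assms by (auto simp: algebra_simps)

lemma unit_circle_factors:
  assumes "\<bar>w\<bar> < 2"
  obtains u v :: complex where "norm u = 1" "norm v = 1"
    "[:1, - of_real w, 1:] = [:- u, 1:] * [:- v, 1:]"
proof -
  define \<theta> where "\<theta> = arccos (w / 2)"
  have "cos \<theta> = w / 2"
    unfolding \<theta>_def using assms by (intro cos_arccos) auto
  then have "cis \<theta> + cis (- \<theta>) = of_real w"
    by (simp add: complex_eq_iff)
  then have "[:1, - of_real w, 1:] = [:- cis \<theta>, 1:] * [:- cis (- \<theta>), 1:]"
    by (intro reciprocal_quadratic_factors) (auto simp: cis_mult)
  then show thesis
    by (intro that) auto
qed

lemma reciprocal_real_factors:
  assumes "w > 2"
  obtains u v :: complex where "norm u < 1" "norm v > 1"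
    "[:1, - of_real w, 1:] = [:- u, 1:] * [:- v, 1:]"
proof -
  define x where "x = arcosh (w / 2)"
  have cosh: "cosh x = w / 2"
    unfolding x_def using assms by (intro cosh_arcosh_real) auto
  have "x > 0"
    unfolding x_def using assms by (intro arcosh_real_gt_1_iff[THEN iffD2]) auto
  have "exp (- x) + exp x = w"
    using cosh by (simp add: cosh_def)
  then have "complex_of_real (exp (- x)) + of_real (exp x) = of_real w"
    by (metis of_real_add)
  moreover have "complex_of_real (exp (- x)) * of_real (exp x) = 1"
    by (simp flip: of_real_mult exp_add)
  ultimately have "[:1, - of_real w, 1:]
      = [:- complex_of_real (exp (- x)), 1:] * [:- complex_of_real (exp x), 1:]"
    by (intro reciprocal_quadratic_factors)
  with \<open>x > 0\<close> show thesis
    by (intro that) auto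
qed

text \<open>The intermediate value theorem gives a root between \<open>-2\<close> and \<open>2\<close>; as the quadratic is
  positive at \<open>2\<close> but tends to \<open>- \<infinity>\<close>, the other root lies to the right of \<open>2\<close>.\<close>

lemma quadratic_roots_separated:
  fixes a b c :: real
  assumes "a < 0" "4 * a + 2 * b + c > 0" "4 * a - 2 * b + c < 0"
  obtains v w where "\<bar>v\<bar> < 2" "w > 2" "b = - a * (v + w)" "c = a * v * w"
proof -
  define Q where "Q x = a * x\<^sup>2 + b * x + c" for x
  have sgn: "Q (-2) < 0" "Q 2 > 0"
    using assms by (simp_all add: Q_def)
  have "\<exists>v\<ge>-2. v \<le> 2 \<and> Q v = 0"
    using sgn by (intro IVT') (auto simp: Q_def intro!: continuous_intros)
  then obtain v where v: "-2 \<le> v" "v \<le> 2" "Q v = 0"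
    by blast
  then have "v \<noteq> -2" "v \<noteq> 2"
    using sgn by auto
  with v have v2: "\<bar>v\<bar> < 2"
    by auto
  define w where "w = - b / a - v"
  have b: "b = - a * (v + w)"
    using assms(1) by (simp add: w_def field_simps)
  have c: "c = a * v * w"
    using v(3) unfolding Q_def b by (simp add: algebra_simps power2_eq_square)
  have "Q 2 = a * (2 - v) * (2 - w)"
    unfolding Q_def b c by (simp add: algebra_simps)
  then have "2 - w < 0"
    using sgn(2) assms(1) v2 by (auto simp: zero_less_mult_iff mult_less_0_iff)
  with that v2 b c show thesis
    by auto
qed

text \<open>The determinant has the form \<open>t ^ 3 * (a * w\<^sup>2 + b * w + c)\<close> with \<open>w = t + 1 / t\<close>; the summand
  \<open>2 * a\<close> in the middle coefficient stems from \<open>w\<^sup>2 = t\<^sup>2 + 2 + 1 / t\<^sup>2\<close>.\<close>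

lemma of_type_quintic:
  fixes a b c :: real and S :: "'n::finite matpoly"
  assumes det: "det S = [:0, of_real a, of_real b, of_real (c + 2 * a), of_real b, of_real a:]"
    and sgn: "a < 0" "4 * a + 2 * b + c > 0" "4 * a - 2 * b + c < 0"
  shows "of_type S 2 2 1"
proof -
  obtain v w where v: "\<bar>v\<bar> < 2" and w: "w > 2" and b: "b = - a * (v + w)" and c: "c = a * v * w"
    using quadratic_roots_separated[OF sgn] .
  obtain z1 z2 :: complex where z: "norm z1 = 1" "norm z2 = 1"
      "[:1, - of_real v, 1:] = [:- z1, 1:] * [:- z2, 1:]"
    using unit_circle_factors[OF v] .
  obtain z3 z4 :: complex where z': "norm z3 < 1" "norm z4 > 1"
      "[:1, - of_real w, 1:] = [:- z3, 1:] * [:- z4, 1:]"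
    using reciprocal_real_factors[OF w] .
  (* The factor t is written as [:- 0, 1:] so that all five linear factors have the same shape. *)
  have "det S = smult (of_real a)
      ([:- 0, 1:] * ([:1, - of_real v, 1:] * [:1, - of_real w, 1:]))"
    unfolding det b c by (simp add: algebra_simps)
  then have fac: "det S = smult (of_real a)
      ([:- 0, 1:] * (([:- z1, 1:] * [:- z2, 1:]) * ([:- z3, 1:] * [:- z4, 1:])))"
    by (simp only: z(3) z'(3))
  have nz: "[:- x, 1:] \<noteq> 0" for x :: complex
    by simp
  have "zeros_in A (det S) = (\<Sum>x\<leftarrow>[0, z1, z2, z3, z4]. if x \<in> A then 1 else 0)" for A
    using sgn(1) unfolding fac
    by (simp only: zeros_in_smult zeros_in_mult zeros_in_linear nz mult_eq_0_iff of_real_eq_0_iff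
        less_imp_neq simp_thms sum_list.Cons sum_list.Nil list.map add.assoc add_0_right)
  moreover have "det S \<noteq> 0"
    using sgn(1) unfolding fac by (simp only: nz mult_eq_0_iff smult_eq_0_iff) simp
  ultimately show ?thesis
    using z(1,2) z'(1,2) by (simp add: of_type_def)
qed

section \<open>The determinant and its signs\<close>

text \<open>The coefficients of \<open>w\<^sup>2\<close>, \<open>w\<close> and \<open>1\<close> in the quadratic \<open>Q\<close> with
  \<open>det (S31 \<rho> \<delta>) = t ^ 3 * Q (t + 1 / t)\<close>.\<close>

definition Q2 :: "real \<Rightarrow> real \<Rightarrow> real" where
  "Q2 \<rho> \<delta> = - 9/80 - 3/700 * \<rho> + 9/5 * \<rho> * \<delta> - 1/11200 * \<rho>\<^sup>2 - 9/140 * \<rho>\<^sup>2 * \<delta> - 27 * \<rho>\<^sup>2 * \<delta>\<^sup>2"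

definition Q1 :: "real \<Rightarrow> real \<Rightarrow> real" where
  "Q1 \<rho> \<delta> = 9/10 - 12/175 * \<rho> + 99/5 * \<rho> * \<delta> + 9/1400 * \<rho>\<^sup>2 + 333/70 * \<rho>\<^sup>2 * \<delta> + 108 * \<rho>\<^sup>2 * \<delta>\<^sup>2"

definition Q0 :: "real \<Rightarrow> real \<Rightarrow> real" where
  "Q0 \<rho> \<delta> = - 63/40 + 417/700 * \<rho> - 216/5 * \<rho> * \<delta> - 131/5600 * \<rho>\<^sup>2 + 1233/70 * \<rho>\<^sup>2 * \<delta>
     - 162 * \<rho>\<^sup>2 * \<delta>\<^sup>2 - 2 * Q2 \<rho> \<delta>"

lemma det_S31:
  "det (S31 \<rho> \<delta>) = [:0, of_real (Q2 \<rho> \<delta>), of_real (Q1 \<rho> \<delta>), of_real (Q0 \<rho> \<delta> + 2 * Q2 \<rho> \<delta>),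
     of_real (Q1 \<rho> \<delta>), of_real (Q2 \<rho> \<delta>):]"
  unfolding det_2 S31_def K31_def M31_def B31_def D31_def Q0_def Q1_def Q2_def
  by (simp add: power2_eq_square) (simp add: field_simps)

lemma Q2_neg:
  assumes "\<rho> > 0" "\<delta> \<ge> 17 / 1680"
  shows "Q2 \<rho> \<delta> < 0"
proof -
  define e where "e = \<delta> - 17 / 1680"
  have e: "e \<ge> 0" and \<delta>: "\<delta> = 17 / 1680 + e"
    using assms by (auto simp: e_def)
  \<comment> \<open>Complete the squares in \<open>\<rho> * e\<close> (exactly) and in \<open>\<rho>\<close> (with the centre rounded to \<open>2\<close>).\<close>
  have "- Q2 \<rho> \<delta> = 27 * (\<rho> * e - 1/30)\<^sup>2 + 157/44800 * (\<rho> - 2)\<^sup>2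
      + 171/280 * (\<rho>\<^sup>2 * e) + 1/11200 * \<rho> + (9/80 - 3/100 - 157/11200)"
    unfolding Q2_def \<delta> by (simp add: field_simps power2_eq_square)
  also have "\<dots> > 0"
    using assms e by (intro add_nonneg_pos add_nonneg_nonneg) auto
  finally show ?thesis
    by simp
qed

text \<open>The value of \<open>Q\<close> at \<open>2\<close> is the determinant at \<open>t = 1\<close>. It has no constant term in \<open>\<rho>\<close> because
  \<open>\<rho> = 0\<close> leaves only the matrices \<open>B\<close>, whose sum has vanishing row sums.\<close>

lemma Q_at_2_pos:
  assumes "\<rho> > 0" "\<delta> \<ge> 17 / 1680"
  shows "4 * Q2 \<rho> \<delta> + 2 * Q1 \<rho> \<delta> + Q0 \<rho> \<delta> > 0"
proof -
  have "4 * Q2 \<rho> \<delta> + 2 * Q1 \<rho> \<delta> + Q0 \<rho> \<delta> = 9/20 * \<rho> + \<rho>\<^sup>2 * (27 * \<delta> - 3/280)"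
    unfolding Q0_def Q1_def Q2_def by (simp add: algebra_simps)
  also have "\<dots> > 0"
    using assms by (intro add_pos_nonneg mult_nonneg_nonneg) auto
  finally show ?thesis .
qed

text \<open>Here the bound on \<open>\<delta>\<close> enters sharply: \<open>17 / 1680\<close> is the larger zero of the coefficient of
  \<open>\<rho>\<^sup>2\<close>. The coefficient of \<open>\<rho>\<close> changes sign earlier, at \<open>\<delta> = 169 / 18480\<close>.\<close>

lemma Q_at_minus_2_neg:
  assumes "\<rho> > 0" "\<delta> \<ge> 17 / 1680"
  shows "4 * Q2 \<rho> \<delta> - 2 * Q1 \<rho> \<delta> + Q0 \<rho> \<delta> < 0"
proof -
  have "- (4 * Q2 \<rho> \<delta> - 2 * Q1 \<rho> \<delta> + Q0 \<rho> \<delta>)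
      = 18/5 + \<rho> * (396/5 * \<delta> - 507/700) + \<rho>\<^sup>2 * (432 * ((\<delta> - 17/1680) * (\<delta> - 1/120)))"
    unfolding Q0_def Q1_def Q2_def by (simp add: field_simps power2_eq_square)
  also have "\<dots> > 0"
    using assms by (intro add_pos_nonneg mult_nonneg_nonneg) auto
  finally show ?thesis
    by simp
qed

theorem proposition5p9:
  fixes \<delta> :: real
  assumes "\<delta> \<ge> 17 / 1680"
  shows "\<forall>\<rho> > 0. of_type (S31 \<rho> \<delta>) 2 2 1"
  using of_type_quintic[OF det_S31 Q2_neg Q_at_2_pos Q_at_minus_2_neg] assms by blast

end
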